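(* Let $n\ge2$ and let $A_1,\dots,A_m\in\mathbb{S}^n$ satisfy $\operatorname{tr}A_i=0$ and $\operatorname{tr}(A_iA_j)=\delta_{ij}$ for all $i,j=1,\dots,m$. Let $\mathbf{b}\in\mathscr{M}$, let $f(\mathbf{y})=\log\operatorname{tr}\exp A(\mathbf{y})-\mathbf{b}^T\mathbf{y}$, and let $(\mathbf{y}_k)_{k\ge0}$ be generated from $\mathbf{y}_0\in\mathbb{R}^m$ by the gradient method $\mathbf{y}_{k+1}=\mathbf{y}_k-2\nabla f(\mathbf{y}_k)$. Then $$\sum_{j=0}^{\infty}\|\nabla f(\mathbf{y}_j)\|_2^2\le f(\mathbf{y}_0),$$ the residual norm $\|\nabla f(\mathbf{y}_k)\|_2$ is non-increasing in $k$, and $$\|\nabla f(\mathbf{y}_k)\|_2\le\sqrt{\frac{f(\mathbf{y}_0)}{k+1}}\quad\text{for all }k\ge0,\qquad f(\mathbf{y}_k)\downarrow\inf_{\mathbf{y}\in\mathbb{R}^m}f(\mathbf{y})\ge0 .$$ Equivalently (for the convergence of the residual), $\mathcal{A}(X(\mathbf{y}_k))-\mathbf{b}\to0$ as $k\to\infty$. When $\mathbf{b}\in\partial\mathscr{M}$, the function $f$ has no minimizer and $\|\mathbf{y}_k\|_2\to\infty$.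
   Context: $\mathbb{S}^n$ is the space of real symmetric $n\times n$ matrices, and $\mathbb{S}^n_1=\{X\in\mathbb{S}^n: X\succeq 0,\ \operatorname{tr}X=1\}$. $\delta_{ij}$ equals $1$ if $i=j$ and $0$ otherwise. $A(\mathbf{y})=\sum_{i=1}^m y_iA_i$, $\mathcal{A}(X)=(\operatorname{tr}(A_iX))_{i=1,\dots,m}$, and the moment body is $\mathscr{M}=\mathcal{A}(\mathbb{S}^n_1)\subset\mathbb{R}^m$, with boundary $\partial\mathscr{M}$ in $\mathbb{R}^m$. The gradient of $f$ is $\nabla f(\mathbf{y})=\mathcal{A}(X(\mathbf{y}))-\mathbf{b}$ with $X(\mathbf{y})=\exp A(\mathbf{y})/\operatorname{tr}\exp A(\mathbf{y})$. The notation $f(\mathbf{y}_k)\downarrow c$ means that the sequence is non-increasing and converges to $c$. *)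

theory Defs
  imports "HOL-Analysis.Analysis"
begin

definition sym_mat :: "real^'n^'n \<Rightarrow> bool" where
  "sym_mat X \<longleftrightarrow> transpose X = X"

definition psd_mat :: "real^'n^'n \<Rightarrow> bool" where
  "psd_mat X \<longleftrightarrow> sym_mat X \<and> (\<forall>v. 0 \<le> v \<bullet> (X *v v))"

definition spectraplex :: "(real^'n^'n) set" where
  "spectraplex = {X. psd_mat X \<and> trace X = 1}"

text \<open>The library's multiplication, power and one on \<^typ>\<open>real^'n^'n\<close> are entrywise,
  so the powers in the exponential series are built from the matrix product.\<close>

primrec mat_pow :: "real^'n^'n \<Rightarrow> nat \<Rightarrow> real^'n^'n" where
  "mat_pow X 0 = mat 1"
| "mat_pow X (Suc k) = X ** mat_pow X k"

definition mat_exp :: "real^'n^'n \<Rightarrow> real^'n^'n" where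
  "mat_exp X = (\<Sum>k. mat_pow X k /\<^sub>R fact k)"

definition lin_comb :: "('m \<Rightarrow> real^'n^'n) \<Rightarrow> real^'m \<Rightarrow> real^'n^'n" where
  "lin_comb A y = (\<Sum>i\<in>UNIV. (y $ i) *\<^sub>R A i)"

definition moment_map :: "('m \<Rightarrow> real^'n^'n) \<Rightarrow> real^'n^'n \<Rightarrow> real^'m" where
  "moment_map A X = (\<chi> i. trace (A i ** X))"

definition moment_body :: "('m \<Rightarrow> real^'n^'n) \<Rightarrow> (real^'m) set" where
  "moment_body A = moment_map A ` spectraplex"

definition gibbs_state :: "('m \<Rightarrow> real^'n^'n) \<Rightarrow> real^'m \<Rightarrow> real^'n^'n" where
  "gibbs_state A y = mat_exp (lin_comb A y) /\<^sub>R trace (mat_exp (lin_comb A y))"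

definition objective :: "('m \<Rightarrow> real^'n^'n) \<Rightarrow> real^'m \<Rightarrow> real^'m \<Rightarrow> real" where
  "objective A b y = ln (trace (mat_exp (lin_comb A y))) - b \<bullet> y"

definition gradient :: "('a::real_inner \<Rightarrow> real) \<Rightarrow> 'a \<Rightarrow> 'a" where
  "gradient f x = (THE D. GDERIV f x :> D)"

lemma gradient_eqI:
  assumes "GDERIV f x :> D"
  shows "gradient f x = D"
  unfolding gradient_def
proof (rule the_equality)
  show "GDERIV f x :> D" by (rule assms)
next
  fix E assume "GDERIV f x :> E"
  then have "(\<lambda>h. h \<bullet> E) = (\<lambda>h. h \<bullet> D)"
    using assms unfolding gderiv_def by (rule has_derivative_unique)
  then have "(E - D) \<bullet> E = (E - D) \<bullet> D"
    by (rule fun_cong)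
  then have "(E - D) \<bullet> (E - D) = 0"
    by (simp add: inner_diff_right)
  then show "E = D"
    by simp
qed

end

theory Submission
  imports Defs "HOL-Probability.Hoeffding"
begin

text \<open>
  Write \<open>H = A(z) - A(x)\<close> and let \<open>\<rho>\<close> be the Gibbs state at \<open>x\<close>. Everything about the
  iteration follows from the two inequalities
  \<open>tr \<rho>H \<le> log tr exp A(z) - log tr exp A(x) \<le> tr \<rho>H + \<parallel>H\<parallel>\<^sup>2 / 4\<close>
  (lemma \<open>log_trace_exp_bounds\<close>). As the \<open>A\<^sub>i\<close> are orthonormal, \<open>\<parallel>H\<parallel> = \<parallel>z - x\<parallel>\<close>, so these say
  that \<open>f\<close> is convex and \<open>1/2\<close>-smooth; they also squeeze the difference quotient, so that the
  gradient formula comes without differentiating a matrix exponential. The step size \<open>2\<close> is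
  exactly the inverse of the smoothness constant.

  The two inequalities are scalar statements in disguise. Diagonalise two symmetric matrices as
  \<open>Y = \<Sum> l\<^sub>i u\<^sub>i u\<^sub>i\<^sup>T\<close> and \<open>Z = \<Sum> m\<^sub>j v\<^sub>j v\<^sub>j\<^sup>T\<close>. The overlaps \<open>c\<^sub>i\<^sub>j = (u\<^sub>i \<bullet> v\<^sub>j)\<^sup>2\<close> form
  a doubly stochastic matrix, and all traces involved depend on the eigenvalues and on \<open>c\<close> only:
  for example, \<open>tr (Z - Y)\<^sup>2 = \<Sum> c\<^sub>i\<^sub>j (m\<^sub>j - l\<^sub>i)\<^sup>2\<close>. The lower bound is Jensen's inequality. In the
  upper bound the left-hand side does not depend on \<open>c\<close> and the right-hand side is affine in
  \<open>c\<close>, with a cost which is, up to terms in \<open>i\<close> alone and in \<open>j\<close> alone, a product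
  \<open>-a\<^sub>i m\<^sub>j\<close>. By the rearrangement inequality this is minimised at a permutation matrix, where
  \<open>Y\<close> and \<open>Z\<close> may be regarded as commuting, and there the bound is Hoeffding's lemma for a finite
  distribution, as the squared range of numbers \<open>h\<^sub>i\<close> is at most \<open>2 \<Sum> h\<^sub>i\<^sup>2\<close>.

  The rest is the theory of the gradient method with step \<open>1/L\<close> for an \<open>L\<close>-smooth convex function:
  sufficient decrease gives the summability of the squared residuals, cocoercivity of the gradient
  the monotonicity of the residual, and the estimate of \<open>gradient_step_gap\<close> the convergence of the
  values to the infimum whether or not it is attained. Nonnegativity of \<open>f\<close> holds because
  \<open>log tr exp Y\<close> dominates the largest eigenvalue of \<open>Y\<close>, hence \<open>tr YX\<close> for every state \<open>X\<close>. Finally, a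
  minimiser would give \<open>b\<close> as the image of a Gibbs state, which is positive definite; perturbing
  it by small traceless combinations of the \<open>A\<^sub>i\<close> shows that such a \<open>b\<close> is interior to the
  moment body. So for \<open>b\<close> on the boundary there is no minimiser, and a bounded subsequence of iterates
  would accumulate at one.
\<close>

section \<open>Spectral decomposition of symmetric matrices\<close>

definition orthonormal_family :: "('n::finite \<Rightarrow> real^'n) \<Rightarrow> bool" where
  "orthonormal_family u \<longleftrightarrow> (\<forall>i j. u i \<bullet> u j = (if i = j then 1 else 0))"

text \<open>The matrix \<open>u u\<^sup>T\<close>, which for a unit vector is the projection onto its line.\<close>

definition rank_one :: "real^'n \<Rightarrow> real^'n^'n" where
  "rank_one u = (\<chi> a b. u $ a * u $ b)"

text \<open>The matrix with eigenvalues \<open>l\<close> and eigenvectors \<open>u\<close>, once \<open>u\<close> is orthonormal. Indexing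
  both by the index type of the matrix makes traces sums over that type, for any choice of
  eigenbasis.\<close>

definition spectral_sum :: "('n::finite \<Rightarrow> real) \<Rightarrow> ('n \<Rightarrow> real^'n) \<Rightarrow> real^'n^'n" where
  "spectral_sum l u = (\<Sum>i\<in>UNIV. l i *\<^sub>R rank_one (u i))"

text \<open>The eigenvector maximises the Rayleigh quotient over the compact unit sphere of the invariant
  subspace.\<close>

lemma self_adjoint_eigenvector:
  fixes T :: "'a::euclidean_space \<Rightarrow> 'a"
  assumes T: "linear T" and sa: "\<And>x y. x \<bullet> T y = T x \<bullet> y"
    and S: "subspace S" and inv: "\<And>x. x \<in> S \<Longrightarrow> T x \<in> S" and x0: "x0 \<in> S" "x0 \<noteq> 0"
  shows "\<exists>v l. v \<in> S \<and> norm v = 1 \<and> T v = l *\<^sub>R v"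
proof -
  let ?K = "S \<inter> sphere 0 1"
  have "compact ?K"
    using closed_subspace[OF S] by (simp add: closed_Int_compact)
  moreover have "x0 /\<^sub>R norm x0 \<in> ?K"
    using x0 S by (auto simp: subspace_mul)
  moreover have "continuous_on ?K (\<lambda>x. x \<bullet> T x)"
    by (intro continuous_intros linear_continuous_on linear_conv_bounded_linear[THEN iffD1] T)
  ultimately obtain v where v: "v \<in> ?K" and max: "\<And>x. x \<in> ?K \<Longrightarrow> x \<bullet> T x \<le> v \<bullet> T v"
    using continuous_attains_sup[of ?K "\<lambda>x. x \<bullet> T x"] by blast
  define l where "l = v \<bullet> T v"
  have vS: "v \<in> S" and vv: "v \<bullet> v = 1"
    using v by (auto simp: dot_square_norm)
  have ray: "x \<bullet> T x \<le> l * (x \<bullet> x)" if "x \<in> S" for x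
  proof (cases "x = 0")
    case False
    then have "x /\<^sub>R norm x \<in> ?K"
      using that S by (auto simp: subspace_mul)
    from max[OF this] have "(x \<bullet> T x) / (norm x * norm x) \<le> l"
      by (simp add: linear_scale[OF T] l_def divide_inverse mult_ac)
    then show ?thesis
      using False by (simp add: divide_le_eq dot_square_norm power2_eq_square)
  qed simp
  \<comment> \<open>The residual of the eigenvalue equation lies in \<open>S\<close>; moving from the maximiser a
    distance \<open>t\<close> in its direction would raise the quotient to first order in \<open>t\<close>.\<close>
  define w where "w = T v - l *\<^sub>R v"
  have wS: "w \<in> S"
    unfolding w_def using inv vS S by (simp add: subspace_diff subspace_mul)
  have vw: "v \<bullet> w = 0"
    by (simp add: w_def inner_diff_right vv l_def)
  have Tvw: "T v \<bullet> w = w \<bullet> w"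
  proof -
    have "T v = w + l *\<^sub>R v" by (simp add: w_def)
    then show ?thesis using vw by (simp add: inner_add_left)
  qed
  have *: "2 * t * (w \<bullet> w) \<le> t\<^sup>2 * (l * (w \<bullet> w) - w \<bullet> T w)" for t
  proof -
    have "(v + t *\<^sub>R w) \<bullet> T (v + t *\<^sub>R w) \<le> l * ((v + t *\<^sub>R w) \<bullet> (v + t *\<^sub>R w))"
      by (rule ray) (use vS wS S in \<open>simp add: subspace_add subspace_mul\<close>)
    moreover have "w \<bullet> T v = w \<bullet> w" "v \<bullet> T w = w \<bullet> w"
      using Tvw sa[of v w] by (simp_all add: inner_commute)
    ultimately show ?thesis
      using vw by (simp add: linear_add[OF T] linear_scale[OF T] inner_add_left inner_add_right
          inner_commute[of w v] vv l_def[symmetric] algebra_simps power2_eq_square)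
  qed
  have "w \<bullet> w \<le> 0"
  proof (rule ccontr)
    assume "\<not> w \<bullet> w \<le> 0"
    then have pos: "w \<bullet> w > 0" by linarith
    define C where "C = \<bar>l * (w \<bullet> w) - w \<bullet> T w\<bar> + 1"
    define t where "t = (w \<bullet> w) / C"
    have C: "C > 0" by (simp add: C_def add_nonneg_pos)
    have t: "t > 0" using C pos by (simp add: t_def)
    have "2 * t * (w \<bullet> w) \<le> t\<^sup>2 * C"
      using *[of t] by (rule order_trans) (auto simp: C_def intro!: mult_left_mono)
    also have "\<dots> = t * (w \<bullet> w)"
      using C by (simp add: t_def power2_eq_square)
    finally show False
      using t pos by (simp add: mult.assoc)
  qed
  then have "w = 0"
    using inner_gt_zero_iff[of w] by linarith
  then show ?thesis
    using v by (intro exI[of _ v] exI[of _ l]) (auto simp: w_def)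
qed

text \<open>A largest orthonormal set of eigenvectors is a basis: its orthogonal complement is invariant,
  so if nonzero it would contain one more eigenvector.\<close>

lemma self_adjoint_eigenbasis:
  fixes T :: "'a::euclidean_space \<Rightarrow> 'a"
  assumes T: "linear T" and sa: "\<And>x y. x \<bullet> T y = T x \<bullet> y"
  shows "\<exists>B. card B = DIM('a) \<and> finite B \<and> pairwise orthogonal B \<and>
    (\<forall>v\<in>B. norm v = 1 \<and> (\<exists>l. T v = l *\<^sub>R v))"
proof -
  define P where "P = (\<lambda>B. pairwise orthogonal B \<and> (\<forall>v\<in>B. norm v = 1 \<and> (\<exists>l. T v = l *\<^sub>R v)))"
  have ind: "independent B" if "P B" for B
    using that by (intro pairwise_orthogonal_independent) (auto simp: P_def)
  have "\<forall>B. P B \<longrightarrow> card B \<le> DIM('a)"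
    using independent_bound ind by blast
  moreover have "P {}"
    by (simp add: P_def)
  ultimately obtain B where B: "P B" and max: "\<And>B'. P B' \<Longrightarrow> card B' \<le> card B"
    using Lattices_Big.ex_has_greatest_nat[of P "{}" card "Suc (DIM('a))"] by (auto simp: less_Suc_eq_le)
  have fin: "finite B" and le: "card B \<le> DIM('a)"
    using independent_bound ind[OF B] by auto
  have "\<not> card B < DIM('a)"
  proof
    assume "card B < DIM('a)"
    then have "dim B < DIM('a)"
      using dim_le_card[OF span_superset fin] by linarith
    then obtain x0 where x0: "x0 \<noteq> 0" "\<And>v. v \<in> B \<Longrightarrow> orthogonal x0 v"
      using orthogonal_to_subspace_exists span_base by metis
    define S where "S = {x. \<forall>v\<in>B. orthogonal v x}"
    have "subspace S"
      unfolding S_def orthogonal_def by (rule subspaceI) (auto simp: inner_add_right)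
    moreover have "T x \<in> S" if x: "x \<in> S" for x
      unfolding S_def orthogonal_def
    proof safe
      fix v assume v: "v \<in> B"
      then obtain l where "T v = l *\<^sub>R v" using B by (auto simp: P_def)
      then show "v \<bullet> T x = 0"
        using sa[of v x] x v by (simp add: S_def orthogonal_def)
    qed
    moreover have "x0 \<in> S"
      using x0 by (auto simp: S_def orthogonal_commute)
    ultimately obtain v l where v: "v \<in> S" "norm v = 1" "T v = l *\<^sub>R v"
      using self_adjoint_eigenvector[OF T sa] x0(1) by metis
    have "v \<notin> B"
      using v by (auto simp: S_def orthogonal_def)
    moreover have "P (insert v B)"
      using B v by (auto simp: P_def S_def pairwise_insert orthogonal_commute)
    ultimately show False
      using max[of "insert v B"] fin by simp
  qed
  then show ?thesis
    using B fin le by (intro exI[of _ B]) (auto simp: P_def)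
qed

lemma rank_one_mult_vec: "rank_one u *v x = (u \<bullet> x) *\<^sub>R u"
  by (simp add: rank_one_def vec_eq_iff matrix_vector_mult_def inner_vec_def sum_distrib_left
      sum_distrib_right mult_ac)

lemma trace_rank_one_mult: "trace (rank_one u ** M) = u \<bullet> (M *v u)"
  unfolding trace_def matrix_matrix_mult_def rank_one_def matrix_vector_mult_def inner_vec_def
  by (simp add: sum_distrib_left mult_ac) (subst sum.swap, simp add: mult_ac)

lemma matrix_mult_sum_left: "sum f S ** (M :: real^'n^'n) = (\<Sum>i\<in>S. f i ** M)"
  by (simp add: vec_eq_iff matrix_matrix_mult_def sum_distrib_right) (intro allI sum.swap)

lemma matrix_vec_sum_left: "sum f S *v (x :: real^'n) = (\<Sum>i\<in>S. f i *v x)"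
  by (induction S rule: infinite_finite_induct) (auto simp: matrix_vector_mult_add_rdistrib)

lemma trace_scaleR: "trace (r *\<^sub>R (M :: real^'n^'n)) = r * trace M"
  by (simp add: trace_def sum_distrib_left)

lemma trace_sum: "trace (\<Sum>i\<in>S. f i :: real^'n^'n) = (\<Sum>i\<in>S. trace (f i))"
  by (simp add: trace_def) (rule sum.swap)

lemma trace_spectral_sum_mult:
  "trace (spectral_sum l u ** M) = (\<Sum>i\<in>UNIV. l i * (u i \<bullet> (M *v u i)))"
  by (simp add: spectral_sum_def matrix_mult_sum_left trace_sum trace_scaleR
      trace_rank_one_mult flip: scalar_matrix_assoc)

lemma trace_spectral_sum_mult_spectral_sum:
  "trace (spectral_sum l u ** spectral_sum m v) = (\<Sum>i\<in>UNIV. \<Sum>j\<in>UNIV. l i * m j * (u i \<bullet> v j)\<^sup>2)"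
  unfolding trace_spectral_sum_mult
  by (simp add: spectral_sum_def matrix_vec_sum_left inner_sum_right
      rank_one_mult_vec sum_distrib_left power2_eq_square inner_commute mult_ac
      flip: scaleR_matrix_vector_assoc)

text \<open>The rows \<open>u\<close> form an orthogonal matrix, and a one-sided inverse of a square matrix is
  two-sided.\<close>

lemma sum_rank_one_orthonormal:
  assumes "orthonormal_family u"
  shows "(\<Sum>i\<in>UNIV. rank_one (u i)) = mat 1"
proof -
  define U where "U = (\<chi> i. u i)"
  have "U ** transpose U = mat 1"
    using assms by (simp add: U_def orthonormal_family_def vec_eq_iff matrix_mult_transpose_dot_row mat_def row_def)
  then have "transpose U ** U = mat 1"
    by (simp add: matrix_left_right_inverse)
  moreover have "transpose U ** U = (\<Sum>i\<in>UNIV. rank_one (u i))"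
    by (simp add: vec_eq_iff matrix_matrix_mult_def U_def transpose_def rank_one_def)
  ultimately show ?thesis by simp
qed

lemma orthonormal_parseval:
  assumes "orthonormal_family u"
  shows "(\<Sum>i\<in>UNIV. (u i \<bullet> x)\<^sup>2) = x \<bullet> x"
proof -
  have "x = (\<Sum>i\<in>UNIV. rank_one (u i)) *v x"
    using sum_rank_one_orthonormal[OF assms] by simp
  also have "\<dots> = (\<Sum>i\<in>UNIV. (u i \<bullet> x) *\<^sub>R u i)"
    by (simp add: matrix_vec_sum_left rank_one_mult_vec)
  finally have "x \<bullet> x = x \<bullet> (\<Sum>i\<in>UNIV. (u i \<bullet> x) *\<^sub>R u i)" by simp
  then show ?thesis
    by (simp add: inner_sum_right power2_eq_square inner_commute)
qed

lemma trace_spectral_sum: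
  assumes "orthonormal_family u"
  shows "trace (spectral_sum l u) = sum l UNIV"
  using trace_spectral_sum_mult[of l u "mat 1"] assms by (simp add: orthonormal_family_def)

lemma trace_eq_sum_orthonormal:
  assumes "orthonormal_family u"
  shows "trace M = (\<Sum>i\<in>UNIV. u i \<bullet> (M *v u i))"
  using trace_spectral_sum_mult[of "\<lambda>_. 1" u M] sum_rank_one_orthonormal[OF assms]
  by (simp add: spectral_sum_def)

lemma spectral_theorem:
  fixes X :: "real^'n^'n"
  assumes "sym_mat X"
  obtains l u where "orthonormal_family u" "X = spectral_sum l u"
proof -
  have sa: "x \<bullet> (X *v y) = (X *v x) \<bullet> y" for x y
    using assms by (metis dot_lmul_matrix sym_mat_def transpose_matrix_vector)
  obtain B where B: "card B = CARD('n)" "finite B" "pairwise orthogonal B"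
    and eig: "\<forall>v\<in>B. norm v = 1 \<and> (\<exists>l. X *v v = l *\<^sub>R v)"
    using self_adjoint_eigenbasis[OF matrix_vector_mul_linear sa] by auto
  obtain u where u: "bij_betw u (UNIV :: 'n set) B"
    using finite_same_card_bij[of "UNIV :: 'n set" B] B by auto
  have uB: "u i \<in> B" for i
    using u by (auto simp: bij_betw_def)
  then have "\<forall>i. \<exists>l. X *v u i = l *\<^sub>R u i"
    using eig by blast
  then obtain l where l: "\<And>i. X *v u i = l i *\<^sub>R u i"
    using choice[of "\<lambda>i l. X *v u i = l *\<^sub>R u i"] by blast
  have on: "orthonormal_family u"
    unfolding orthonormal_family_def
  proof (intro allI)
    fix i j show "u i \<bullet> u j = (if i = j then 1 else 0)"
    proof (cases "i = j")
      case True then show ?thesis using eig uB by (simp add: dot_square_norm)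
    next
      case False
      then have "u i \<noteq> u j" using u by (auto simp: bij_betw_def inj_on_def)
      then show ?thesis using B(3) uB False by (simp add: pairwise_def orthogonal_def)
    qed
  qed
  have "X *v x = spectral_sum l u *v x" for x
  proof -
    have "X *v x = X *v ((\<Sum>i\<in>UNIV. rank_one (u i)) *v x)"
      using sum_rank_one_orthonormal[OF on] by simp
    also have "\<dots> = (\<Sum>i\<in>UNIV. (u i \<bullet> x) *\<^sub>R (X *v u i))"
      by (simp add: matrix_vec_sum_left rank_one_mult_vec vec.sum matrix_vector_mult_scaleR
          linear_sum[OF matrix_vector_mul_linear])
    also have "\<dots> = spectral_sum l u *v x"
      by (simp add: l spectral_sum_def matrix_vec_sum_left rank_one_mult_vec mult.commute
          flip: scaleR_matrix_vector_assoc)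
    finally show ?thesis .
  qed
  then have "X = spectral_sum l u"
    by (simp add: matrix_eq)
  with on show thesis by (rule that)
qed

lemma mat_pow_spectral_sum:
  assumes "orthonormal_family u"
  shows "mat_pow (spectral_sum l u) k = spectral_sum (\<lambda>i. l i ^ k) u"
proof (induction k)
  case 0
  then show ?case using sum_rank_one_orthonormal[OF assms] by (simp add: spectral_sum_def)
next
  case (Suc k)
  have "spectral_sum l u *v (spectral_sum m u *v x) = spectral_sum (\<lambda>i. l i * m i) u *v x"
    for m x
  proof -
    have "spectral_sum l u *v (spectral_sum m u *v x) =
        (\<Sum>i\<in>UNIV. \<Sum>j\<in>UNIV. (l i * (m j * (u j \<bullet> x)) * (u i \<bullet> u j)) *\<^sub>R u i)"
      by (simp add: spectral_sum_def matrix_vec_sum_left rank_one_mult_vec inner_sum_right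
          scaleR_sum_left scaleR_sum_right sum_distrib_left mult_ac flip: scaleR_matrix_vector_assoc)
    also have "\<dots> = (\<Sum>i\<in>UNIV. (l i * (m i * (u i \<bullet> x))) *\<^sub>R u i)"
      using assms by (simp add: orthonormal_family_def if_distrib[of "\<lambda>t. (_ * t) *\<^sub>R _"] cong: if_cong)
    also have "\<dots> = spectral_sum (\<lambda>i. l i * m i) u *v x"
      by (simp add: spectral_sum_def matrix_vec_sum_left rank_one_mult_vec mult_ac
          flip: scaleR_matrix_vector_assoc)
    finally show ?thesis .
  qed
  then show ?case
    by (simp add: Suc matrix_eq flip: matrix_vector_mul_assoc)
qed

lemma mat_exp_spectral_sum:
  assumes "orthonormal_family u"
  shows "mat_exp (spectral_sum l u) = spectral_sum (\<lambda>i. exp (l i)) u"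
proof -
  have "(\<lambda>k. \<Sum>i\<in>UNIV. (l i ^ k /\<^sub>R fact k) *\<^sub>R rank_one (u i)) sums
      (\<Sum>i\<in>UNIV. exp (l i) *\<^sub>R rank_one (u i))"
    by (intro sums_sum sums_scaleR_left exp_converges)
  moreover have "(\<Sum>i\<in>UNIV. (l i ^ k /\<^sub>R fact k) *\<^sub>R rank_one (u i)) =
      mat_pow (spectral_sum l u) k /\<^sub>R fact k" for k
    unfolding mat_pow_spectral_sum[OF assms] by (simp add: spectral_sum_def scaleR_sum_right)
  ultimately show ?thesis
    unfolding mat_exp_def spectral_sum_def[of "\<lambda>i. exp (l i)"] by (simp add: sums_iff)
qed

section \<open>Doubly stochastic matrices and rearrangement\<close>

definition doubly_stochastic :: "('n::finite \<Rightarrow> 'n \<Rightarrow> real) \<Rightarrow> bool" where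
  "doubly_stochastic c \<longleftrightarrow> (\<forall>i j. 0 \<le> c i j) \<and> (\<forall>i. (\<Sum>j\<in>UNIV. c i j) = 1) \<and>
    (\<forall>j. (\<Sum>i\<in>UNIV. c i j) = 1)"

text \<open>Terms of a transport cost that depend on one index only do not see the coupling. This is the
  only way in which the marginal conditions enter below.\<close>

lemma doubly_stochastic_sum_row:
  "doubly_stochastic c \<Longrightarrow> (\<Sum>i\<in>UNIV. \<Sum>j\<in>UNIV. c i j * s i) = (\<Sum>i\<in>UNIV. s i)"
  by (simp add: doubly_stochastic_def flip: sum_distrib_right)

lemma doubly_stochastic_sum_col:
  "doubly_stochastic c \<Longrightarrow> (\<Sum>i\<in>UNIV. \<Sum>j\<in>UNIV. c i j * s j) = (\<Sum>j\<in>UNIV. s j)"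
  by (subst sum.swap) (simp add: doubly_stochastic_def flip: sum_distrib_right)

lemma sorting_enumeration:
  fixes a :: "'n::finite \<Rightarrow> real"
  obtains e where "bij_betw e {..<CARD('n)} UNIV"
    "\<And>i j. i \<le> j \<Longrightarrow> j < CARD('n) \<Longrightarrow> a (e i) \<le> a (e j)"
proof -
  obtain xs :: "'n list" where xs: "set xs = UNIV" "distinct xs"
    using finite_distinct_list[of "UNIV :: 'n set"] by auto
  define ys where "ys = sort_key a xs"
  have ys: "set ys = UNIV" "distinct ys" "sorted (map a ys)"
    using xs by (auto simp: ys_def)
  have len: "length ys = CARD('n)"
    using distinct_card[OF ys(2)] ys(1) by simp
  have "bij_betw ((!) ys) {..<CARD('n)} UNIV"
    using bij_betw_nth[OF ys(2), of "{..<CARD('n)}" UNIV] len ys(1) by simp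
  moreover have "a (ys ! i) \<le> a (ys ! j)" if "i \<le> j" "j < CARD('n)" for i j
    using sorted_nth_mono[OF ys(3), of i j] that len by simp
  ultimately show thesis by (rule that)
qed

text \<open>For sorted sequences the sum \<open>f\<close> below plays the role of a convex function with slope
  \<open>b\<^sub>k\<close> between \<open>a\<^sub>k\<close> and \<open>a\<^sub>k\<^sub>+\<^sub>1\<close>, and \<open>a\<^sub>l b\<^sub>l - f\<^sub>l\<close> that of its conjugate. The claim is
  the Fenchel--Young inequality; equality on the diagonal is built in. In transport terms, the pair
  certifies that the diagonal coupling is optimal.\<close>

lemma discrete_legendre_potential:
  fixes a b :: "nat \<Rightarrow> real"
  assumes a: "\<And>i j. i \<le> j \<Longrightarrow> j < n \<Longrightarrow> a i \<le> a j"
    and b: "\<And>i j. i \<le> j \<Longrightarrow> j < n \<Longrightarrow> b i \<le> b j"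
  obtains f where "\<And>k l. k < n \<Longrightarrow> l < n \<Longrightarrow> a k * b l \<le> f k + (a l * b l - f l)"
proof -
  define f where "f = (\<lambda>k. \<Sum>t<k. (a (Suc t) - a t) * b t)"
  have up: "(a k - a l) * b l \<le> f k - f l" if "l \<le> k" "k < n" for k l
    using that
  proof (induction k rule: dec_induct)
    case (step k)
    then have "(a (Suc k) - a k) * b l \<le> (a (Suc k) - a k) * b k"
      by (intro mult_left_mono b) (auto simp: a)
    then show ?case using step by (simp add: f_def algebra_simps)
  qed simp
  have down: "f k - f l \<le> (a k - a l) * b k" if "l \<le> k" "k < n" for k l
    using that
  proof (induction l rule: inc_induct)
    case (step l)
    then have "(a (Suc l) - a l) * b l \<le> (a (Suc l) - a l) * b k"
      by (intro mult_left_mono b) (auto simp: a)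
    then show ?case using step by (simp add: f_def algebra_simps)
  qed simp
  have "a k * b l \<le> f k + (a l * b l - f l)" if "k < n" "l < n" for k l
    using up[of l k] down[of k l] that by (cases "l \<le> k") (auto simp: algebra_simps)
  then show thesis by (rule that)
qed

text \<open>The rearrangement inequality, with couplings instead of permutations as competitors. The
  permutation pairs equal ranks; the potentials of the preceding lemma give a bound that is separable
  and hence the same for all couplings. This takes the place of Birkhoff's theorem on the extreme
  points of the doubly stochastic matrices.\<close>

lemma rearrangement_doubly_stochastic:
  fixes a b :: "'n::finite \<Rightarrow> real"
  obtains s where "bij s"
    "\<And>c. doubly_stochastic c \<Longrightarrow>
      (\<Sum>i\<in>UNIV. \<Sum>j\<in>UNIV. c i j * (a i * b j)) \<le> (\<Sum>i\<in>UNIV. a i * b (s i))"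
proof -
  obtain d where d: "bij_betw d {..<CARD('n)} UNIV"
    and ad: "\<And>i j. i \<le> j \<Longrightarrow> j < CARD('n) \<Longrightarrow> a (d i) \<le> a (d j)"
    using sorting_enumeration[of a] by metis
  obtain e where e: "bij_betw e {..<CARD('n)} UNIV"
    and be: "\<And>i j. i \<le> j \<Longrightarrow> j < CARD('n) \<Longrightarrow> b (e i) \<le> b (e j)"
    using sorting_enumeration[of b] by metis
  obtain f where f: "\<And>k l. k < CARD('n) \<Longrightarrow> l < CARD('n) \<Longrightarrow>
      a (d k) * b (e l) \<le> f k + (a (d l) * b (e l) - f l)"
    using discrete_legendre_potential[of "CARD('n)" "a \<circ> d" "b \<circ> e"] ad be by auto
  define d' where "d' = the_inv_into {..<CARD('n)} d"
  define e' where "e' = the_inv_into {..<CARD('n)} e"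
  have d': "bij_betw d' UNIV {..<CARD('n)}" and e': "bij_betw e' UNIV {..<CARD('n)}"
    unfolding d'_def e'_def by (intro bij_betw_the_inv_into d e)+
  have dd: "d (d' i) = i" "d' i < CARD('n)" for i
    using f_the_inv_into_f_bij_betw[OF d, of i] d' by (auto simp: d'_def bij_betw_def)
  have ee: "e (e' i) = i" "e' i < CARD('n)" for i
    using f_the_inv_into_f_bij_betw[OF e, of i] e' by (auto simp: e'_def bij_betw_def)
  show thesis
  proof (rule that)
    show "bij (e \<circ> d')"
      using bij_betw_trans[OF d' e] .
  next
    fix c :: "'n \<Rightarrow> 'n \<Rightarrow> real" assume c: "doubly_stochastic c"
    define g where "g = (\<lambda>l. a (d l) * b (e l) - f l)"
    have "(\<Sum>i\<in>UNIV. \<Sum>j\<in>UNIV. c i j * (a i * b j)) \<le>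
        (\<Sum>i\<in>UNIV. \<Sum>j\<in>UNIV. c i j * (f (d' i) + g (e' j)))"
    proof (intro sum_mono mult_left_mono)
      fix i j
      show "a i * b j \<le> f (d' i) + g (e' j)"
        using f[OF dd(2)[of i] ee(2)[of j]] dd(1) ee(1) by (simp add: g_def)
      show "0 \<le> c i j" using c by (simp add: doubly_stochastic_def)
    qed
    also have "\<dots> = (\<Sum>i\<in>UNIV. f (d' i)) + (\<Sum>j\<in>UNIV. g (e' j))"
      using doubly_stochastic_sum_row[OF c, of "\<lambda>i. f (d' i)"]
        doubly_stochastic_sum_col[OF c, of "\<lambda>j. g (e' j)"]
      by (simp add: distrib_left sum.distrib)
    also have "\<dots> = (\<Sum>k<CARD('n). f k) + (\<Sum>k<CARD('n). g k)"
      using sum.reindex_bij_betw[OF d', of f] sum.reindex_bij_betw[OF e', of g] by simp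
    also have "\<dots> = (\<Sum>k<CARD('n). a (d k) * b (e k))"
      by (simp add: g_def sum_subtractf)
    also have "\<dots> = (\<Sum>i\<in>UNIV. a (d (d' i)) * b (e (d' i)))"
      by (rule sum.reindex_bij_betw[OF d', symmetric])
    finally show "(\<Sum>i\<in>UNIV. \<Sum>j\<in>UNIV. c i j * (a i * b j)) \<le>
        (\<Sum>i\<in>UNIV. a i * b ((e \<circ> d') i))"
      by (simp add: dd)
  qed
qed

section \<open>Log-sum-exp along a coupling\<close>

text \<open>Only the two extreme entries matter, and \<open>(s - t)\<^sup>2 \<le> 2 (s\<^sup>2 + t\<^sup>2)\<close>. This is where the
  smoothness constant \<open>1/2\<close> comes from: it turns the \<open>1/8\<close> of Hoeffding's lemma into \<open>1/4\<close>.\<close>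

lemma sq_range_le_two_sum_squares:
  fixes h :: "'n::finite \<Rightarrow> real"
  shows "(Max (range h) - Min (range h))\<^sup>2 \<le> 2 * (\<Sum>i\<in>UNIV. (h i)\<^sup>2)"
proof -
  obtain i j where ij: "Max (range h) = h i" "Min (range h) = h j"
  proof -
    have "Max (range h) \<in> range h" "Min (range h) \<in> range h"
      by (auto intro: Max_in Min_in)
    then show thesis using that by blast
  qed
  show ?thesis
  proof (cases "i = j")
    case True then show ?thesis by (simp add: ij sum_nonneg)
  next
    case False
    then have "(h i)\<^sup>2 + (h j)\<^sup>2 = (\<Sum>k\<in>{i,j}. (h k)\<^sup>2)" by simp
    also have "\<dots> \<le> (\<Sum>k\<in>UNIV. (h k)\<^sup>2)"
      by (intro sum_mono2) auto
    finally have "(h i)\<^sup>2 + (h j)\<^sup>2 \<le> (\<Sum>k\<in>UNIV. (h k)\<^sup>2)" .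
    moreover have "(h i - h j)\<^sup>2 \<le> 2 * ((h i)\<^sup>2 + (h j)\<^sup>2)"
      using zero_le_power2[of "h i + h j"] by (simp add: power2_eq_square algebra_simps)
    ultimately show ?thesis by (simp add: ij)
  qed
qed

text \<open>Hoeffding's lemma has the squared range of \<open>h\<close> in place of the sum of squares. The sum is what a
  coupling can average: for increments \<open>m\<^sub>j - l\<^sub>i\<close> it becomes a transport cost.\<close>

lemma hoeffding_finite:
  fixes p h :: "'n::finite \<Rightarrow> real"
  assumes p: "\<And>i. 0 \<le> p i" and p1: "(\<Sum>i\<in>UNIV. p i) = 1"
  shows "(\<Sum>i\<in>UNIV. p i * exp (h i)) \<le>
    exp ((\<Sum>i\<in>UNIV. p i * h i) + (\<Sum>i\<in>UNIV. (h i)\<^sup>2) / 4)"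
proof -
  define M where "M = embed_pmf p"
  have "(\<integral>\<^sup>+x. ennreal (p x) \<partial>count_space UNIV) = 1"
    by (simp add: nn_integral_count_space_finite sum_ennreal p p1)
  then have pmf: "pmf M i = p i" for i
    unfolding M_def by (intro pmf_embed_pmf) (auto simp: p)
  interpret interval_bounded_random_variable "measure_pmf M" h "Min (range h)" "Max (range h)"
    by unfold_locales auto
  have E: "measure_pmf.expectation M g = (\<Sum>i\<in>UNIV. p i * g i)" for g :: "'n \<Rightarrow> real"
    by (subst integral_measure_pmf_real[of UNIV]) (auto simp: pmf mult.commute)
  define \<mu> where "\<mu> = (\<Sum>i\<in>UNIV. p i * h i)"
  have "ennreal (measure_pmf.expectation M (\<lambda>x. exp (h x - \<mu>))) =
      nn_integral (measure_pmf M) (\<lambda>x. ennreal (exp (h x - \<mu>)))"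
    by (intro nn_integral_eq_integral[symmetric] integrable_measure_pmf_finite) auto
  also have "\<dots> \<le> ennreal (exp ((Max (range h) - Min (range h))\<^sup>2 / 8))"
    using Hoeffdings_lemma_nn_integral[of 1] by (simp add: E \<mu>_def)
  also have "\<dots> \<le> ennreal (exp ((\<Sum>i\<in>UNIV. (h i)\<^sup>2) / 4))"
    using sq_range_le_two_sum_squares[of h] by (intro ennreal_leI) simp
  finally have "(\<Sum>i\<in>UNIV. p i * exp (h i - \<mu>)) \<le> exp ((\<Sum>i\<in>UNIV. (h i)\<^sup>2) / 4)"
    by (subst (asm) ennreal_le_iff) (auto simp: E)
  moreover have "(\<Sum>i\<in>UNIV. p i * exp (h i)) = exp \<mu> * (\<Sum>i\<in>UNIV. p i * exp (h i - \<mu>))"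
    by (simp add: exp_diff sum_distrib_left)
  ultimately show ?thesis
    by (simp add: \<mu>_def exp_add)
qed

text \<open>These are the eigenvalues of the Gibbs state \<open>exp Y / tr exp Y\<close> when \<open>l\<close> lists those of \<open>Y\<close>.\<close>

definition softmax :: "('n::finite \<Rightarrow> real) \<Rightarrow> 'n \<Rightarrow> real" where
  "softmax l i = exp (l i) / (\<Sum>k\<in>UNIV. exp (l k))"

lemma sum_exp_pos: "(\<Sum>k\<in>(UNIV :: 'n::finite set). exp (l k :: real)) > 0"
  by (intro sum_pos) auto

lemma softmax_pos: "softmax l i > 0"
  by (simp add: softmax_def sum_exp_pos)

lemma sum_softmax: "(\<Sum>i\<in>UNIV. softmax l i) = 1"
  using sum_exp_pos[of l] by (simp add: softmax_def flip: sum_divide_distrib)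

text \<open>Jensen's inequality for the weights \<open>c\<^sub>i\<^sub>j softmax l i\<close>: replace the exponential by its tangent
  at the mean \<open>\<kappa>\<close> of \<open>m\<^sub>j - l\<^sub>i\<close>. In matrix form this becomes the Peierls--Bogoliubov
  inequality.\<close>

lemma logsumexp_coupling_lower:
  fixes l m :: "'n::finite \<Rightarrow> real"
  assumes c: "doubly_stochastic c"
  shows "ln (\<Sum>i\<in>UNIV. exp (l i)) + (\<Sum>i\<in>UNIV. \<Sum>j\<in>UNIV. c i j * (softmax l i * (m j - l i)))
    \<le> ln (\<Sum>j\<in>UNIV. exp (m j))"
proof -
  define S where "S = (\<Sum>i\<in>UNIV. exp (l i))"
  define \<kappa> where "\<kappa> = (\<Sum>i\<in>UNIV. \<Sum>j\<in>UNIV. c i j * (softmax l i * (m j - l i)))"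
  have S: "S > 0" by (simp add: S_def sum_exp_pos)
  have el: "exp (l i) = S * softmax l i" for i
    using S by (simp add: softmax_def S_def)
  have "(\<Sum>i\<in>UNIV. \<Sum>j\<in>UNIV. c i j * (exp (l i) * (exp \<kappa> * (1 + (m j - l i - \<kappa>))))) =
      (\<Sum>i\<in>UNIV. \<Sum>j\<in>UNIV. S * exp \<kappa> * (1 - \<kappa>) * (c i j * softmax l i)
        + S * exp \<kappa> * (c i j * (softmax l i * (m j - l i))))"
    unfolding el by (intro sum.cong refl) (simp add: algebra_simps)
  also have "\<dots> = S * exp \<kappa> * (1 - \<kappa>) * (\<Sum>i\<in>UNIV. \<Sum>j\<in>UNIV. c i j * softmax l i) + S * exp \<kappa> * \<kappa>"
    unfolding \<kappa>_def sum.distrib sum_distrib_left[symmetric] ..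
  also have "\<dots> = S * exp \<kappa>"
    using doubly_stochastic_sum_row[OF c, of "softmax l"] by (simp add: sum_softmax algebra_simps)
  finally have "S * exp \<kappa> = (\<Sum>i\<in>UNIV. \<Sum>j\<in>UNIV. c i j * (exp (l i) * (exp \<kappa> * (1 + (m j - l i - \<kappa>)))))" ..
  also have "\<dots> \<le> (\<Sum>i\<in>UNIV. \<Sum>j\<in>UNIV. c i j * exp (m j))"
  proof (intro sum_mono mult_left_mono)
    fix i j
    have "exp (l i) * (exp \<kappa> * (1 + (m j - l i - \<kappa>))) \<le> exp (l i) * (exp \<kappa> * exp (m j - l i - \<kappa>))"
      by (intro mult_left_mono exp_ge_add_one_self) auto
    then show "exp (l i) * (exp \<kappa> * (1 + (m j - l i - \<kappa>))) \<le> exp (m j)"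
      by (simp flip: exp_add)
    show "0 \<le> c i j" using c by (simp add: doubly_stochastic_def)
  qed
  also have "\<dots> = (\<Sum>j\<in>UNIV. exp (m j))"
    by (rule doubly_stochastic_sum_col[OF c])
  finally have "ln (S * exp \<kappa>) \<le> ln (\<Sum>j\<in>UNIV. exp (m j))"
    using S sum_exp_pos[of m] by (subst ln_le_cancel_iff) auto
  then show ?thesis
    using S by (simp add: ln_mult S_def \<kappa>_def)
qed

text \<open>Only the right-hand side depends on \<open>c\<close>, and completing the square shows that its coupling
  cost is \<open>-a\<^sub>i m\<^sub>j\<close> up to separable terms. So the worst \<open>c\<close> is a permutation, for which the
  inequality is Hoeffding's lemma for the increments \<open>h\<close>.\<close>

lemma logsumexp_coupling_upper:
  fixes l m :: "'n::finite \<Rightarrow> real"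
  assumes c: "doubly_stochastic c"
  shows "ln (\<Sum>j\<in>UNIV. exp (m j)) \<le> ln (\<Sum>i\<in>UNIV. exp (l i))
    + (\<Sum>i\<in>UNIV. \<Sum>j\<in>UNIV. c i j * (softmax l i * (m j - l i)))
    + (\<Sum>i\<in>UNIV. \<Sum>j\<in>UNIV. c i j * (m j - l i)\<^sup>2) / 4"
proof -
  define S where "S = (\<Sum>i\<in>UNIV. exp (l i))"
  have S: "S > 0" by (simp add: S_def sum_exp_pos)
  define p where "p = softmax l"
  define a where "a = (\<lambda>i. l i / 2 - p i)"
  define r where "r = (\<lambda>i. (l i)\<^sup>2 / 4 - p i * l i)"
  \<comment> \<open>Completing the square, with \<open>x\<close> standing for \<open>m\<^sub>j\<close>: the only mixed term is \<open>a i * x\<close>.\<close>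
  have cost: "p i * (x - l i) + (x - l i)\<^sup>2 / 4 = r i + x\<^sup>2 / 4 - a i * x" for i x
    by (simp add: a_def r_def power2_eq_square field_simps)
  obtain s where s: "bij s" and "\<And>c. doubly_stochastic c \<Longrightarrow>
      (\<Sum>i\<in>UNIV. \<Sum>j\<in>UNIV. c i j * (a i * m j)) \<le> (\<Sum>i\<in>UNIV. a i * m (s i))"
    using rearrangement_doubly_stochastic[of a m] by blast
  note opt = this(2)[OF c]
  define h where "h = (\<lambda>i. m (s i) - l i)"
  have "(\<Sum>j\<in>UNIV. exp (m j)) = (\<Sum>i\<in>UNIV. exp (m (s i)))"
    using sum.reindex_bij_betw[OF s, of "\<lambda>j. exp (m j)"] by simp
  also have "\<dots> = S * (\<Sum>i\<in>UNIV. p i * exp (h i))"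
    using S by (simp add: p_def softmax_def S_def[symmetric] h_def exp_diff sum_distrib_left)
  also have "\<dots> \<le> S * exp ((\<Sum>i\<in>UNIV. p i * h i) + (\<Sum>i\<in>UNIV. (h i)\<^sup>2) / 4)"
    using S hoeffding_finite[of p h]
    by (intro mult_left_mono) (auto simp: p_def sum_softmax softmax_pos less_imp_le)
  finally have "ln (\<Sum>j\<in>UNIV. exp (m j)) \<le>
      ln (S * exp ((\<Sum>i\<in>UNIV. p i * h i) + (\<Sum>i\<in>UNIV. (h i)\<^sup>2) / 4))"
    using S sum_exp_pos[of m] by (subst ln_le_cancel_iff) auto
  also have "\<dots> = ln S + ((\<Sum>i\<in>UNIV. p i * h i) + (\<Sum>i\<in>UNIV. (h i)\<^sup>2) / 4)"
    using S by (simp add: ln_mult)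
  also have "(\<Sum>i\<in>UNIV. p i * h i) + (\<Sum>i\<in>UNIV. (h i)\<^sup>2) / 4 =
      (\<Sum>i\<in>UNIV. r i + (m (s i))\<^sup>2 / 4 - a i * m (s i))"
    by (simp add: h_def sum_divide_distrib cost flip: sum.distrib)
  also have "\<dots> = (\<Sum>i\<in>UNIV. r i) + (\<Sum>j\<in>UNIV. (m j)\<^sup>2 / 4) - (\<Sum>i\<in>UNIV. a i * m (s i))"
    using sum.reindex_bij_betw[OF s, of "\<lambda>j. (m j)\<^sup>2 / 4"]
    by (simp add: sum.distrib sum_subtractf)
  also have "\<dots> \<le> (\<Sum>i\<in>UNIV. r i) + (\<Sum>j\<in>UNIV. (m j)\<^sup>2 / 4)
      - (\<Sum>i\<in>UNIV. \<Sum>j\<in>UNIV. c i j * (a i * m j))"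
    using opt by simp
  also have "\<dots> = (\<Sum>i\<in>UNIV. \<Sum>j\<in>UNIV. c i j * (r i + (m j)\<^sup>2 / 4 - a i * m j))"
    unfolding doubly_stochastic_sum_row[OF c, of r, symmetric]
      doubly_stochastic_sum_col[OF c, of "\<lambda>j. (m j)\<^sup>2 / 4", symmetric]
    by (simp only: sum.distrib sum_subtractf distrib_left right_diff_distrib)
  also have "\<dots> = (\<Sum>i\<in>UNIV. \<Sum>j\<in>UNIV. c i j * (p i * (m j - l i)))
      + (\<Sum>i\<in>UNIV. \<Sum>j\<in>UNIV. c i j * (m j - l i)\<^sup>2) / 4"
    unfolding cost[symmetric] by (simp add: distrib_left sum.distrib sum_divide_distrib)
  finally show ?thesis
    by (simp add: S_def p_def)
qed

section \<open>The gradient method for smooth convex functions\<close>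

text \<open>Convexity and \<open>L\<close>-smoothness stated as a sandwich between a tangent plane and a paraboloid.
  Differentiability is a consequence, so that \<open>g\<close> can be an arbitrary candidate for the
  gradient.\<close>

definition convex_smooth :: "real \<Rightarrow> ('a::real_inner \<Rightarrow> real) \<Rightarrow> ('a \<Rightarrow> 'a) \<Rightarrow> bool" where
  "convex_smooth L f g \<longleftrightarrow> (\<forall>x z. f x + g x \<bullet> (z - x) \<le> f z \<and>
     f z \<le> f x + g x \<bullet> (z - x) + L / 2 * (norm (z - x))\<^sup>2)"

lemma convex_smooth_lower: "convex_smooth L f g \<Longrightarrow> f x + g x \<bullet> (z - x) \<le> f z"
  by (simp add: convex_smooth_def)

lemma convex_smooth_upper:
  "convex_smooth L f g \<Longrightarrow> f z \<le> f x + g x \<bullet> (z - x) + L / 2 * (norm (z - x))\<^sup>2"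
  by (simp add: convex_smooth_def)

text \<open>The sandwich bounds the error of the linear approximation quadratically.\<close>

lemma convex_smooth_GDERIV:
  fixes f :: "'a::real_inner \<Rightarrow> real"
  assumes "convex_smooth L f g"
  shows "GDERIV f x :> g x"
  unfolding gderiv_def has_derivative_at
proof
  show "bounded_linear (\<lambda>h. h \<bullet> g x)"
    by (rule bounded_linear_inner_left)
  have bound: "norm (norm (f (x + h) - f x - h \<bullet> g x) / norm h) \<le> \<bar>L\<bar> / 2 * norm h" for h
  proof -
    have "\<bar>f (x + h) - f x - h \<bullet> g x\<bar> \<le> L / 2 * (norm h)\<^sup>2"
      using convex_smooth_lower[OF assms, of x "x + h"] convex_smooth_upper[OF assms, of "x + h" x]
      by (simp add: inner_commute)
    also have "\<dots> \<le> \<bar>L\<bar> / 2 * norm h * norm h"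
      by (simp add: power2_eq_square mult_right_mono flip: mult.assoc)
    finally show ?thesis
      by (cases "h = 0") (simp_all add: divide_le_eq)
  qed
  have "(\<lambda>h :: 'a. \<bar>L\<bar> / 2 * norm h) \<midarrow>0\<rightarrow> \<bar>L\<bar> / 2 * norm (0 :: 'a)"
    by (rule tendsto_mult[OF tendsto_const tendsto_norm[OF tendsto_ident_at]])
  then have lim: "(\<lambda>h :: 'a. \<bar>L\<bar> / 2 * norm h) \<midarrow>0\<rightarrow> 0"
    by simp
  show "(\<lambda>h. norm (f (x + h) - f x - h \<bullet> g x) / norm h) \<midarrow>0\<rightarrow> 0"
    by (rule Lim_null_comparison[OF always_eventually lim]) (rule allI, rule bound)
qed

text \<open>Compare both bounds at the point \<open>w\<close> reached from \<open>z\<close> by a gradient step for the function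
  \<open>f - g x \<bullet> _\<close>, whose minimum is at \<open>x\<close>.\<close>

lemma convex_smooth_bregman_lower:
  assumes f: "convex_smooth L f g" and L: "L > 0"
  shows "f x + g x \<bullet> (z - x) + (norm (g x - g z))\<^sup>2 / (2 * L) \<le> f z"
proof -
  define d where "d = g z - g x"
  define w where "w = z - d /\<^sub>R L"
  have "f x + g x \<bullet> (z - x) - (g x \<bullet> d) / L \<le> f w"
    using convex_smooth_lower[OF f, of x w]
    by (simp add: w_def inner_diff_right divide_inverse mult.commute)
  also have "f w \<le> f z + g z \<bullet> (w - z) + L / 2 * (norm (w - z))\<^sup>2"
    by (rule convex_smooth_upper[OF f])
  also have "\<dots> = f z - (g z \<bullet> d) / L + (d \<bullet> d) / (2 * L)"
    using L by (simp add: w_def power_mult_distrib power2_norm_eq_inner[symmetric])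
      (simp add: field_simps power2_eq_square)
  finally have "f x + g x \<bullet> (z - x) + ((g z - g x) \<bullet> d) / L - (d \<bullet> d) / (2 * L) \<le> f z"
    by (simp add: inner_diff_left diff_divide_distrib)
  moreover have "(d \<bullet> d) / L = 2 * ((d \<bullet> d) / (2 * L))" by simp
  ultimately have "f x + g x \<bullet> (z - x) + (d \<bullet> d) / (2 * L) \<le> f z"
    unfolding d_def[symmetric] by linarith
  then show ?thesis
    by (simp add: d_def power2_norm_eq_inner[symmetric] norm_minus_commute)
qed

text \<open>Add the preceding inequality to itself with the two points exchanged.\<close>

lemma convex_smooth_cocoercive:
  assumes f: "convex_smooth L f g" and L: "L > 0"
  shows "(norm (g x - g z))\<^sup>2 / L \<le> (g x - g z) \<bullet> (x - z)"
proof -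
  have "g x \<bullet> (z - x) + g z \<bullet> (x - z) = - ((g x - g z) \<bullet> (x - z))"
    by (simp add: inner_diff_left inner_diff_right)
  then show ?thesis
    using convex_smooth_bregman_lower[OF f L, of x z] convex_smooth_bregman_lower[OF f L, of z x]
    by (simp add: norm_minus_commute field_simps)
qed

lemma gradient_step_decrease:
  assumes f: "convex_smooth L f g" and L: "L > 0"
  shows "f (x - g x /\<^sub>R L) \<le> f x - (norm (g x))\<^sup>2 / (2 * L)"
  using convex_smooth_upper[OF f, of "x - g x /\<^sub>R L" x] L
  by (simp add: power_mult_distrib field_simps power2_eq_square flip: power2_norm_eq_inner)

text \<open>Cocoercivity between \<open>x\<close> and its successor, whose difference is \<open>g x / L\<close>, says that the new
  gradient \<open>h\<close> satisfies \<open>h \<bullet> h \<le> g x \<bullet> h\<close>.\<close>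

lemma gradient_step_gradient_norm:
  assumes f: "convex_smooth L f g" and L: "L > 0"
  shows "norm (g (x - g x /\<^sub>R L)) \<le> norm (g x)"
proof -
  define h where "h = g (x - g x /\<^sub>R L)"
  have "(norm (g x - h))\<^sup>2 / L \<le> ((g x - h) \<bullet> g x) / L"
    using convex_smooth_cocoercive[OF f L, of x "x - g x /\<^sub>R L"]
    by (simp add: h_def divide_inverse mult.commute)
  then have "(norm (g x - h))\<^sup>2 \<le> (g x - h) \<bullet> g x"
    using L by (simp add: divide_le_cancel)
  then have "h \<bullet> h \<le> g x \<bullet> h"
    by (simp add: power2_norm_eq_inner inner_diff_left inner_diff_right inner_commute)
  then have "norm h * norm h \<le> norm (g x) * norm h"
    using norm_cauchy_schwarz[of "g x" h] by (simp add: dot_square_norm power2_eq_square)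
  then show ?thesis
    unfolding h_def[symmetric] by (cases "h = 0") simp_all
qed

text \<open>The right-hand side telescopes along the iteration for each fixed comparison point \<open>z\<close>. As \<open>z\<close>
  need not be a minimiser, this controls the values even if the infimum is not attained.\<close>

lemma gradient_step_gap:
  assumes f: "convex_smooth L f g" and L: "L > 0"
  shows "f (x - g x /\<^sub>R L) - f z \<le>
    L / 2 * ((norm (x - z))\<^sup>2 - (norm (x - g x /\<^sub>R L - z))\<^sup>2)"
proof -
  have "(norm (x - g x /\<^sub>R L - z))\<^sup>2 =
      (norm (x - z))\<^sup>2 - 2 * (g x \<bullet> (x - z)) / L + (norm (g x))\<^sup>2 / L\<^sup>2"
  proof -
    have "x - g x /\<^sub>R L - z = (x - z) - g x /\<^sub>R L" by simp
    then show ?thesis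
      by (simp only: power2_norm_eq_inner)
        (simp add: inner_diff_left[of "x - z"] inner_diff_right[of _ "x - z"] inner_commute
          divide_inverse power2_eq_square algebra_simps)
  qed
  then have "L / 2 * ((norm (x - z))\<^sup>2 - (norm (x - g x /\<^sub>R L - z))\<^sup>2) =
      g x \<bullet> (x - z) - (norm (g x))\<^sup>2 / (2 * L)"
    using L by (simp add: field_simps power2_eq_square)
  moreover have "g x \<bullet> (z - x) = - (g x \<bullet> (x - z))"
    by (simp add: inner_diff_right)
  ultimately show ?thesis
    using gradient_step_decrease[OF f L, of x] convex_smooth_lower[OF f, of x z] by linarith
qed

lemma gradient_descent_decseq:
  assumes f: "convex_smooth L f g" and L: "L > 0" and y: "\<And>k. y (Suc k) = y k - g (y k) /\<^sub>R L"
  shows "decseq (\<lambda>k. f (y k))" "decseq (\<lambda>k. norm (g (y k)))"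
proof -
  have "f (y (Suc k)) \<le> f (y k)" for k
  proof -
    have "0 \<le> (norm (g (y k)))\<^sup>2 / (2 * L)" using L by simp
    then show ?thesis using gradient_step_decrease[OF f L, of "y k"] unfolding y by linarith
  qed
  then show "decseq (\<lambda>k. f (y k))" by (rule decseq_SucI)
  show "decseq (\<lambda>k. norm (g (y k)))"
    by (rule decseq_SucI) (simp only: y gradient_step_gradient_norm[OF f L])
qed

lemma gradient_descent_sum_sq_le:
  assumes f: "convex_smooth L f g" and L: "L > 0" and y: "\<And>k. y (Suc k) = y k - g (y k) /\<^sub>R L"
  shows "(\<Sum>j<n. (norm (g (y j)))\<^sup>2) \<le> 2 * L * (f (y 0) - f (y n))"
proof (induction n)
  case (Suc n)
  have "(norm (g (y n)))\<^sup>2 \<le> 2 * L * (f (y n) - f (y (Suc n)))"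
    using gradient_step_decrease[OF f L, of "y n"] L unfolding y by (simp add: field_simps)
  with Suc show ?case by (simp add: algebra_simps)
qed simp

text \<open>If the limit \<open>l\<close> of the values exceeded some \<open>f z\<close>, the telescoped gaps to \<open>f z\<close> would grow
  linearly while remaining below \<open>L / 2 * (norm (y 0 - z))\<^sup>2\<close>.\<close>

lemma gradient_descent_minimizing:
  assumes f: "convex_smooth L f g" and L: "L > 0" and y: "\<And>k. y (Suc k) = y k - g (y k) /\<^sub>R L"
    and bdd: "bdd_below (range f)"
  shows "(\<lambda>k. f (y k)) \<longlonglongrightarrow> (INF z. f z)"
proof -
  note dec = gradient_descent_decseq(1)[where y = y, OF f L y]
  have ge: "(INF z. f z) \<le> f (y k)" for k
    by (rule cINF_lower[OF bdd]) simp
  then obtain l where l: "(\<lambda>k. f (y k)) \<longlonglongrightarrow> l" and lle: "\<And>k. l \<le> f (y k)"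
    using decseq_convergent[OF dec] by metis
  have "l \<le> f z" for z
  proof (rule ccontr)
    assume "\<not> l \<le> f z"
    then have pos: "l - f z > 0" by simp
    have "real n * (l - f z) \<le> L / 2 * ((norm (y 0 - z))\<^sup>2 - (norm (y n - z))\<^sup>2)" for n
    proof (induction n)
      case (Suc n)
      have "l - f z \<le> L / 2 * ((norm (y n - z))\<^sup>2 - (norm (y (Suc n) - z))\<^sup>2)"
        using gradient_step_gap[OF f L, of "y n" z] lle[of "Suc n"] unfolding y by linarith
      with Suc show ?case by (simp add: algebra_simps)
    qed simp
    then have bound: "real n * (l - f z) \<le> L / 2 * (norm (y 0 - z))\<^sup>2" for n
      by (rule order_trans) (use L in \<open>simp add: mult_left_mono\<close>)
    obtain n where "L / 2 * (norm (y 0 - z))\<^sup>2 < real n * (l - f z)"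
      using reals_Archimedean3[OF pos] by blast
    with bound[of n] show False by linarith
  qed
  then have "l \<le> (INF z. f z)" by (intro cINF_greatest) auto
  moreover have "(INF z. f z) \<le> l" using ge by (intro LIMSEQ_le_const[OF l]) auto
  ultimately have "l = (INF z. f z)" by (rule antisym)
  with l show ?thesis by simp
qed

text \<open>A bounded subsequence would accumulate at a point where \<open>f\<close> takes the value \<open>c\<close>.\<close>

lemma minimizing_sequence_norm_at_top:
  fixes f :: "'a::{real_normed_vector, heine_borel} \<Rightarrow> real"
  assumes cont: "continuous_on UNIV f" and lim: "(\<lambda>k. f (y k)) \<longlonglongrightarrow> c"
    and nomin: "\<And>z. f z \<noteq> c"
  shows "filterlim (\<lambda>k. norm (y k)) at_top sequentially"
proof (rule ccontr)
  assume "\<not> ?thesis"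
  then obtain R where R: "\<not> eventually (\<lambda>k. R \<le> norm (y k)) sequentially"
    unfolding filterlim_at_top by blast
  then have "\<exists>\<^sub>F k in sequentially. y k \<in> cball 0 R"
    by (auto simp: not_eventually elim!: frequently_elim1)
  then have "infinite {k. y k \<in> cball 0 R}"
    by (simp add: cofinite_eq_sequentially[symmetric] frequently_cofinite)
  then obtain r :: "nat \<Rightarrow> nat" where r: "strict_mono r" "\<And>k. y (r k) \<in> cball 0 R"
    using infinite_enumerate by blast
  have "\<exists>z\<in>cball 0 R. \<exists>s. strict_mono s \<and> ((y \<circ> r) \<circ> s) \<longlonglongrightarrow> z"
    using compact_cball[of "0 :: 'a" R] r(2) unfolding compact_def by (metis comp_apply)
  then obtain z s where s: "strict_mono (s :: nat \<Rightarrow> nat)" "((y \<circ> r) \<circ> s) \<longlonglongrightarrow> z"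
    by blast
  have "(\<lambda>k. f (((y \<circ> r) \<circ> s) k)) \<longlonglongrightarrow> f z"
    by (rule continuous_on_tendsto_compose[OF cont s(2)]) auto
  moreover have "(\<lambda>k. f (((y \<circ> r) \<circ> s) k)) \<longlonglongrightarrow> c"
    using LIMSEQ_subseq_LIMSEQ[OF lim strict_mono_o[OF r(1) s(1)]] by (simp add: o_def)
  ultimately have "f z = c" by (rule LIMSEQ_unique)
  with nomin show False by blast
qed

section \<open>Trace inequalities for the matrix exponential\<close>

text \<open>Both marginal conditions are Parseval's identity for a unit vector.\<close>

lemma doubly_stochastic_overlap:
  assumes "orthonormal_family u" "orthonormal_family v"
  shows "doubly_stochastic (\<lambda>i j. (u i \<bullet> v j)\<^sup>2)"
  unfolding doubly_stochastic_def
proof (intro conjI allI)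
  fix i j
  show "0 \<le> (u i \<bullet> v j)\<^sup>2" by simp
  show "(\<Sum>j\<in>UNIV. (u i \<bullet> v j)\<^sup>2) = 1"
    using orthonormal_parseval[OF assms(2), of "u i"] assms(1)
    by (simp add: inner_commute orthonormal_family_def)
  show "(\<Sum>i\<in>UNIV. (u i \<bullet> v j)\<^sup>2) = 1"
    using orthonormal_parseval[OF assms(1), of "v j"] assms(2)
    by (simp add: orthonormal_family_def)
qed

lemma matrix_sub_ldistrib: "(M :: real^'n^'n) ** (B - C) = M ** B - M ** C"
  by (simp add: vec_eq_iff matrix_matrix_mult_def right_diff_distrib sum_subtractf)

lemma matrix_sub_rdistrib: "((B :: real^'n^'n) - C) ** M = B ** M - C ** M"
  by (simp add: vec_eq_iff matrix_matrix_mult_def left_diff_distrib sum_subtractf)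

lemma trace_spectral_sum_mult_same:
  assumes "orthonormal_family u"
  shows "trace (spectral_sum p u ** spectral_sum l u) = (\<Sum>i\<in>UNIV. p i * l i)"
proof -
  have "l i * m j * (u i \<bullet> u j)\<^sup>2 = (if i = j then l i * m j else 0)" for l m and i j :: 'a
    using assms by (simp add: orthonormal_family_def)
  then show ?thesis by (simp add: trace_spectral_sum_mult_spectral_sum)
qed

lemma trace_spectral_sum_mult_diff:
  assumes u: "orthonormal_family u" and v: "orthonormal_family v"
  shows "trace (spectral_sum p u ** (spectral_sum m v - spectral_sum l u)) =
    (\<Sum>i\<in>UNIV. \<Sum>j\<in>UNIV. (u i \<bullet> v j)\<^sup>2 * (p i * (m j - l i)))"
proof -
  have "trace (spectral_sum p u ** (spectral_sum m v - spectral_sum l u)) =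
      trace (spectral_sum p u ** spectral_sum m v) - (\<Sum>i\<in>UNIV. p i * l i)"
    by (simp add: matrix_sub_ldistrib trace_sub trace_spectral_sum_mult_same[OF u])
  also have "(\<Sum>i\<in>UNIV. p i * l i) = (\<Sum>i\<in>UNIV. \<Sum>j\<in>UNIV. (u i \<bullet> v j)\<^sup>2 * (p i * l i))"
    by (rule doubly_stochastic_sum_row[OF doubly_stochastic_overlap[OF u v], symmetric])
  finally show ?thesis
    by (simp add: trace_spectral_sum_mult_spectral_sum right_diff_distrib sum_subtractf mult_ac)
qed

lemma trace_diff_spectral_sum_sq:
  assumes u: "orthonormal_family u" and v: "orthonormal_family v"
  shows "trace ((spectral_sum m v - spectral_sum l u) ** (spectral_sum m v - spectral_sum l u)) =
    (\<Sum>i\<in>UNIV. \<Sum>j\<in>UNIV. (u i \<bullet> v j)\<^sup>2 * (m j - l i)\<^sup>2)"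
proof -
  note ds = doubly_stochastic_overlap[OF u v]
  have "trace ((spectral_sum m v - spectral_sum l u) ** (spectral_sum m v - spectral_sum l u)) =
      (\<Sum>j\<in>UNIV. m j * m j) + (\<Sum>i\<in>UNIV. l i * l i)
      - 2 * trace (spectral_sum l u ** spectral_sum m v)"
    by (simp add: matrix_sub_ldistrib matrix_sub_rdistrib trace_sub
        trace_spectral_sum_mult_same u v trace_mul_sym[of "spectral_sum m v" "spectral_sum l u"])
  also have "\<dots> = (\<Sum>i\<in>UNIV. \<Sum>j\<in>UNIV. (u i \<bullet> v j)\<^sup>2 * (m j * m j) + (u i \<bullet> v j)\<^sup>2 * (l i * l i)
      - 2 * (l i * m j * (u i \<bullet> v j)\<^sup>2))"
    using doubly_stochastic_sum_row[OF ds, of "\<lambda>i. l i * l i"]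
      doubly_stochastic_sum_col[OF ds, of "\<lambda>j. m j * m j"]
    by (simp add: trace_spectral_sum_mult_spectral_sum sum.distrib sum_subtractf sum_distrib_left)
  also have "\<dots> = (\<Sum>i\<in>UNIV. \<Sum>j\<in>UNIV. (u i \<bullet> v j)\<^sup>2 * (m j - l i)\<^sup>2)"
    by (intro sum.cong refl) (simp add: power2_eq_square algebra_simps)
  finally show ?thesis .
qed

lemma trace_mat_exp_spectral_sum:
  "orthonormal_family u \<Longrightarrow> trace (mat_exp (spectral_sum l u)) = (\<Sum>i\<in>UNIV. exp (l i))"
  by (simp add: mat_exp_spectral_sum trace_spectral_sum)

lemma normalized_mat_exp_spectral_sum:
  assumes "orthonormal_family u"
  shows "mat_exp (spectral_sum l u) /\<^sub>R trace (mat_exp (spectral_sum l u)) =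
    spectral_sum (softmax l) u"
  unfolding trace_mat_exp_spectral_sum[OF assms]
  unfolding mat_exp_spectral_sum[OF assms]
  by (simp add: spectral_sum_def scaleR_sum_right softmax_def divide_inverse mult.commute)

text \<open>The first inequality is that of Peierls and Bogoliubov, the second a quadratic upper bound in
  the Frobenius norm. Both are the coupling inequalities for the
  overlaps of the two eigenbases.\<close>

lemma log_trace_exp_bounds:
  fixes Y Z :: "real^'n^'n"
  assumes "sym_mat Y" "sym_mat Z"
  defines "\<rho> \<equiv> mat_exp Y /\<^sub>R trace (mat_exp Y)"
  shows "ln (trace (mat_exp Y)) + trace (\<rho> ** (Z - Y)) \<le> ln (trace (mat_exp Z))"
    and "ln (trace (mat_exp Z)) \<le> ln (trace (mat_exp Y)) + trace (\<rho> ** (Z - Y))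
      + trace ((Z - Y) ** (Z - Y)) / 4"
proof -
  obtain l u where u: "orthonormal_family u" and Y: "Y = spectral_sum l u"
    using spectral_theorem[OF assms(1)] by blast
  obtain m v where v: "orthonormal_family v" and Z: "Z = spectral_sum m v"
    using spectral_theorem[OF assms(2)] by blast
  have \<rho>: "\<rho> = spectral_sum (softmax l) u"
    unfolding \<rho>_def Y by (rule normalized_mat_exp_spectral_sum[OF u])
  note simps = \<rho> Y Z trace_mat_exp_spectral_sum[OF u]
    trace_mat_exp_spectral_sum[OF v] trace_spectral_sum_mult_diff[OF u v]
    trace_diff_spectral_sum_sq[OF u v]
  note ds = doubly_stochastic_overlap[OF u v]
  show "ln (trace (mat_exp Y)) + trace (\<rho> ** (Z - Y)) \<le> ln (trace (mat_exp Z))"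
    unfolding simps by (rule logsumexp_coupling_lower[OF ds])
  show "ln (trace (mat_exp Z)) \<le> ln (trace (mat_exp Y)) + trace (\<rho> ** (Z - Y))
      + trace ((Z - Y) ** (Z - Y)) / 4"
    unfolding simps by (rule logsumexp_coupling_upper[OF ds])
qed

text \<open>In an eigenbasis of \<open>Y\<close> the left-hand side is an average of eigenvalues with weights
  \<open>u i \<bullet> (X *v u i)\<close>, and each eigenvalue is at most \<open>ln (\<Sum>i. exp (l i))\<close>.\<close>

lemma trace_mult_le_log_trace_exp:
  assumes Y: "sym_mat Y" and X: "X \<in> spectraplex"
  shows "trace (Y ** X) \<le> ln (trace (mat_exp Y))"
proof -
  obtain l u where u: "orthonormal_family u" and Yl: "Y = spectral_sum l u"
    using spectral_theorem[OF Y] by blast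
  define S where "S = (\<Sum>i\<in>UNIV. exp (l i))"
  have S: "S > 0" by (simp add: S_def sum_exp_pos)
  have "l i \<le> ln S" for i
  proof -
    have "exp (l i) \<le> S"
      unfolding S_def by (rule member_le_sum) auto
    then show ?thesis using S by (simp add: ln_ge_iff)
  qed
  then have "trace (Y ** X) \<le> (\<Sum>i\<in>UNIV. ln S * (u i \<bullet> (X *v u i)))"
    using X unfolding Yl trace_spectral_sum_mult spectraplex_def psd_mat_def
    by (intro sum_mono mult_right_mono) auto
  also have "\<dots> = ln S * trace X"
    by (simp add: trace_eq_sum_orthonormal[OF u] sum_distrib_left)
  also have "\<dots> = ln (trace (mat_exp Y))"
    using X by (simp add: spectraplex_def S_def Yl trace_mat_exp_spectral_sum[OF u])
  finally show ?thesis .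
qed

section \<open>The objective function\<close>

lemma sym_mat_lin_comb: "(\<And>i. sym_mat (A i)) \<Longrightarrow> sym_mat (lin_comb A y)"
  by (simp add: sym_mat_def lin_comb_def vec_eq_iff transpose_def)

lemma lin_comb_diff: "lin_comb A (z - y) = lin_comb A z - lin_comb A y"
  by (simp add: lin_comb_def scaleR_diff_left sum_subtractf)

lemma trace_lin_comb_mult: "trace (lin_comb A y ** X) = y \<bullet> moment_map A X"
  by (simp add: lin_comb_def matrix_mult_sum_left trace_sum trace_scaleR moment_map_def inner_vec_def
      flip: scalar_matrix_assoc)

text \<open>By orthonormality, the moment map is a left inverse of the linear pencil. In particular it is
  onto, and \<open>lin_comb A\<close> is an isometry for the Frobenius norm.\<close>

lemma moment_map_lin_comb:
  assumes "\<And>i j. trace (A i ** A j) = (if i = j then 1 else 0)"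
  shows "moment_map A (lin_comb A y) = y"
proof -
  have "trace (A i ** lin_comb A y) = y $ i" for i
    by (subst trace_mul_sym)
      (simp add: trace_lin_comb_mult moment_map_def assms inner_vec_def if_distrib cong: if_cong)
  then show ?thesis by (simp add: moment_map_def vec_eq_iff)
qed

text \<open>The pencil is an isometry, so the quarter of the squared Frobenius norm in the trace inequality
  is \<open>L / 2 * (norm (z - x))\<^sup>2\<close> with \<open>L = 1/2\<close>; the term linear in \<open>b\<close> shifts the function and its
  candidate gradient alike.\<close>

lemma convex_smooth_objective:
  fixes A :: "'m::finite \<Rightarrow> real^'n^'n"
  assumes sym: "\<And>i. sym_mat (A i)"
    and orth: "\<And>i j. trace (A i ** A j) = (if i = j then 1 else 0)"
  shows "convex_smooth (1/2) (objective A b) (\<lambda>y. moment_map A (gibbs_state A y) - b)"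
  unfolding convex_smooth_def
proof (intro allI)
  fix x z :: "real^'m"
  define h where "h = z - x"
  have h: "lin_comb A z - lin_comb A x = lin_comb A h"
    by (simp add: h_def lin_comb_diff)
  have "trace (gibbs_state A x ** lin_comb A h) = h \<bullet> moment_map A (gibbs_state A x)"
    by (subst trace_mul_sym) (rule trace_lin_comb_mult)
  moreover have "trace (lin_comb A h ** lin_comb A h) = (norm h)\<^sup>2"
    by (simp add: trace_lin_comb_mult moment_map_lin_comb[OF orth] dot_square_norm)
  ultimately show "objective A b x + (moment_map A (gibbs_state A x) - b) \<bullet> (z - x) \<le> objective A b z \<and>
      objective A b z \<le> objective A b x + (moment_map A (gibbs_state A x) - b) \<bullet> (z - x)
        + 1 / 2 / 2 * (norm (z - x))\<^sup>2"
    using log_trace_exp_bounds[OF sym_mat_lin_comb[of A x, OF sym] sym_mat_lin_comb[of A z, OF sym]]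
    unfolding gibbs_state_def[symmetric] h
    unfolding objective_def h_def inner_diff_left inner_diff_right
    by (simp add: inner_commute)
qed

lemma objective_nonneg:
  assumes sym: "\<And>i. sym_mat (A i)" and b: "b \<in> moment_body A"
  shows "0 \<le> objective A b y"
proof -
  obtain X where X: "X \<in> spectraplex" "b = moment_map A X"
    using b by (auto simp: moment_body_def)
  show ?thesis
    using trace_mult_le_log_trace_exp[OF sym_mat_lin_comb[of A y, OF sym] X(1)]
    by (simp add: objective_def X(2) trace_lin_comb_mult inner_commute)
qed

section \<open>Gibbs states have interior moments\<close>

text \<open>The least softmax weight serves as \<open>\<delta>\<close>.\<close>

lemma gibbs_state_positive_definite:
  assumes "\<And>i. sym_mat (A i)"
  obtains \<delta> where "\<delta> > 0" "\<And>x. \<delta> * (x \<bullet> x) \<le> x \<bullet> (gibbs_state A y *v x)"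
    "sym_mat (gibbs_state A y)" "trace (gibbs_state A y) = 1"
proof -
  obtain l u where u: "orthonormal_family u" and Y: "lin_comb A y = spectral_sum l u"
    using spectral_theorem[OF sym_mat_lin_comb[of A y, OF assms]] by blast
  have G: "gibbs_state A y = spectral_sum (softmax l) u"
    unfolding gibbs_state_def Y by (rule normalized_mat_exp_spectral_sum[OF u])
  define \<delta> where "\<delta> = Min (range (softmax l))"
  have "\<delta> > 0" by (simp add: \<delta>_def softmax_pos)
  moreover have "\<delta> * (x \<bullet> x) \<le> x \<bullet> (gibbs_state A y *v x)" for x
  proof -
    have "\<delta> * (x \<bullet> x) = (\<Sum>i\<in>UNIV. \<delta> * (u i \<bullet> x)\<^sup>2)"
      by (simp add: orthonormal_parseval[OF u] flip: sum_distrib_left)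
    also have "\<dots> \<le> (\<Sum>i\<in>UNIV. softmax l i * (u i \<bullet> x)\<^sup>2)"
      by (intro sum_mono mult_right_mono) (auto simp: \<delta>_def)
    also have "\<dots> = x \<bullet> (gibbs_state A y *v x)"
      by (simp add: G spectral_sum_def matrix_vec_sum_left rank_one_mult_vec inner_sum_right
          power2_eq_square inner_commute mult_ac flip: scaleR_matrix_vector_assoc)
    finally show ?thesis .
  qed
  moreover have "sym_mat (gibbs_state A y)"
    by (simp add: G sym_mat_def spectral_sum_def rank_one_def vec_eq_iff transpose_def mult_ac)
  moreover have "trace (gibbs_state A y) = 1"
    by (simp add: G trace_spectral_sum[OF u] sum_softmax)
  ultimately show thesis by (rule that)
qed

lemma quadratic_form_lin_comb_bound:
  obtains K where "K > 0" "\<And>h x. \<bar>x \<bullet> (lin_comb A h *v x)\<bar> \<le> K * norm h * (x \<bullet> x)"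
proof -
  have "\<exists>B>0. \<forall>x. norm (A i *v x) \<le> B * norm x" for i
    using linear_bounded_pos[OF matrix_vector_mul_linear[of "A i"]] by blast
  then obtain B where B: "\<And>i. B i > 0" "\<And>i x. norm (A i *v x) \<le> B i * norm x"
    by metis
  define K where "K = (\<Sum>i\<in>UNIV. B i)"
  have "K > 0" unfolding K_def by (intro sum_pos) (auto simp: B)
  moreover have "\<bar>x \<bullet> (lin_comb A h *v x)\<bar> \<le> K * norm h * (x \<bullet> x)" for h x
  proof -
    have "\<bar>x \<bullet> (lin_comb A h *v x)\<bar> = \<bar>\<Sum>i\<in>UNIV. h $ i * (x \<bullet> (A i *v x))\<bar>"
      by (simp add: lin_comb_def matrix_vec_sum_left inner_sum_right flip: scaleR_matrix_vector_assoc)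
    also have "\<dots> \<le> (\<Sum>i\<in>UNIV. norm h * (B i * (x \<bullet> x)))"
    proof (intro sum_abs[THEN order_trans] sum_mono)
      fix i
      have "\<bar>x \<bullet> (A i *v x)\<bar> \<le> norm x * (B i * norm x)"
        by (rule order_trans[OF Cauchy_Schwarz_ineq2]) (intro mult_left_mono B norm_ge_zero)
      then show "\<bar>h $ i * (x \<bullet> (A i *v x))\<bar> \<le> norm h * (B i * (x \<bullet> x))"
        unfolding abs_mult
        by (intro mult_mono component_le_norm_cart) (auto simp: dot_square_norm power2_eq_square mult_ac)
    qed
    also have "\<dots> = K * norm h * (x \<bullet> x)"
      by (simp add: K_def sum_distrib_left sum_distrib_right mult_ac)
    finally show ?thesis .
  qed
  ultimately show thesis by (rule that)
qed

text \<open>A nearby point \<open>c\<close> is the image of \<open>G + A(h)\<close> with \<open>h\<close> the displacement of \<open>c\<close>: the trace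
  stays \<open>1\<close> because the \<open>A\<^sub>i\<close> are traceless, and positivity survives small \<open>h\<close> because \<open>G\<close> is
  positive definite.\<close>

lemma moment_map_gibbs_state_interior:
  assumes sym: "\<And>i. sym_mat (A i)" and tr0: "\<And>i. trace (A i) = 0"
    and orth: "\<And>i j. trace (A i ** A j) = (if i = j then 1 else 0)"
  shows "moment_map A (gibbs_state A y) \<in> interior (moment_body A)"
proof -
  define G where "G = gibbs_state A y"
  obtain \<delta> where \<delta>: "\<delta> > 0" "\<And>x. \<delta> * (x \<bullet> x) \<le> x \<bullet> (G *v x)" and G: "sym_mat G" "trace G = 1"
    using gibbs_state_positive_definite[of A y, OF sym] unfolding G_def by blast
  obtain K where K: "K > 0" "\<And>h x. \<bar>x \<bullet> (lin_comb A h *v x)\<bar> \<le> K * norm h * (x \<bullet> x)"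
    using quadratic_form_lin_comb_bound[of A] by blast
  have "c \<in> moment_body A" if c: "c \<in> ball (moment_map A G) (\<delta> / K)" for c
  proof -
    define h where "h = c - moment_map A G"
    have h: "K * norm h \<le> \<delta>"
      using c K(1) by (simp add: h_def dist_norm norm_minus_commute field_simps)
    define X where "X = G + lin_comb A h"
    have "0 \<le> x \<bullet> (X *v x)" for x
    proof -
      have "K * norm h * (x \<bullet> x) \<le> \<delta> * (x \<bullet> x)"
        using h by (intro mult_right_mono) auto
      then show ?thesis
        using K(2)[of x h] \<delta>(2)[of x]
        by (simp add: X_def matrix_vector_mult_add_rdistrib inner_add_right abs_le_iff)
    qed
    moreover have "sym_mat X"
      using G(1) sym_mat_lin_comb[of A h, OF sym] by (simp add: X_def sym_mat_def transpose_def vec_eq_iff)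
    moreover have "trace X = 1"
      by (simp add: X_def trace_add G(2) lin_comb_def trace_sum trace_scaleR tr0)
    ultimately have "X \<in> spectraplex"
      by (simp add: spectraplex_def psd_mat_def)
    moreover have "moment_map A X = c"
    proof -
      have "moment_map A X = moment_map A G + moment_map A (lin_comb A h)"
        by (simp add: X_def moment_map_def matrix_add_ldistrib trace_add vec_eq_iff)
      then show ?thesis
        by (simp add: moment_map_lin_comb[OF orth] h_def)
    qed
    ultimately show ?thesis
      by (auto simp: moment_body_def)
  qed
  then have "ball (moment_map A G) (\<delta> / K) \<subseteq> moment_body A" by blast
  then show ?thesis
    unfolding G_def[symmetric] using \<delta>(1) K(1) by (auto simp: mem_interior intro!: exI[of _ "\<delta> / K"])
qed

section \<open>Convergence of the iteration\<close>

theorem theorem6: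
  fixes A :: "'m::finite \<Rightarrow> real^'n^'n"
    and b :: "real^'m"
    and y :: "nat \<Rightarrow> real^'m"
    and f :: "real^'m \<Rightarrow> real"
  assumes "CARD('n) \<ge> 2"
    and "\<And>i. sym_mat (A i)"
    and "\<And>i. trace (A i) = 0"
    and "\<And>i j. trace (A i ** A j) = (if i = j then 1 else 0)"
    and "b \<in> moment_body A"
    and "f = objective A b"
    and "\<And>k. y (Suc k) = y k - 2 *\<^sub>R gradient f (y k)"
  shows "summable (\<lambda>j. (norm (gradient f (y j)))\<^sup>2)
       \<and> (\<Sum>j. (norm (gradient f (y j)))\<^sup>2) \<le> f (y 0)
       \<and> decseq (\<lambda>k. norm (gradient f (y k)))
       \<and> (\<forall>k. norm (gradient f (y k)) \<le> sqrt (f (y 0) / (real k + 1)))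
       \<and> decseq (\<lambda>k. f (y k))
       \<and> (\<lambda>k. f (y k)) \<longlonglongrightarrow> (INF z. f z)
       \<and> bdd_below (range f) \<and> (INF z. f z) \<ge> 0
       \<and> (\<lambda>k. moment_map A (gibbs_state A (y k)) - b) \<longlonglongrightarrow> 0
       \<and> (b \<in> frontier (moment_body A) \<longrightarrow>
            (\<nexists>z. \<forall>w. f z \<le> f w) \<and>
            filterlim (\<lambda>k. norm (y k)) at_top sequentially)"
proof -
  define g where "g = (\<lambda>y. moment_map A (gibbs_state A y) - b)"
  have f: "convex_smooth (1/2) f g"
    unfolding assms(6) g_def by (rule convex_smooth_objective[OF assms(2,4)])
  note deriv = convex_smooth_GDERIV[OF f]
  have grad: "gradient f = g"
    by (rule ext) (rule gradient_eqI[OF deriv])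
  have L: "(1/2 :: real) > 0" by simp
  have y: "y (Suc k) = y k - g (y k) /\<^sub>R (1/2)" for k
    using assms(7)[of k] by (simp add: grad)
  have nonneg: "0 \<le> f z" for z
    unfolding assms(6) by (rule objective_nonneg[OF assms(2,5)])
  have bdd: "bdd_below (range f)"
    using nonneg by (intro bdd_belowI[of _ 0]) auto
  have Inf: "(INF z. f z) \<ge> 0"
    by (intro cINF_greatest) (auto simp: nonneg)
  note dec = gradient_descent_decseq[where y = y, OF f L y]
  note lim = gradient_descent_minimizing[where y = y, OF f L y bdd]
  have partial: "(\<Sum>j<n. (norm (g (y j)))\<^sup>2) \<le> f (y 0)" for n
    using gradient_descent_sum_sq_le[where y = y and n = n, OF f L y] nonneg[of "y n"] by simp
  have summ: "summable (\<lambda>j. (norm (g (y j)))\<^sup>2)"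
    by (rule summableI_nonneg_bounded[OF _ partial]) simp
  have sum_le: "(\<Sum>j. (norm (g (y j)))\<^sup>2) \<le> f (y 0)"
    by (rule suminf_le_const[OF summ partial])
  have rate: "norm (g (y k)) \<le> sqrt (f (y 0) / (real k + 1))" for k
  proof (rule real_le_rsqrt)
    have "(\<Sum>j<Suc k. (norm (g (y k)))\<^sup>2) \<le> (\<Sum>j<Suc k. (norm (g (y j)))\<^sup>2)"
      using dec(2) by (intro sum_mono power_mono) (auto simp: decseq_def)
    with partial[of "Suc k"] have "(real k + 1) * (norm (g (y k)))\<^sup>2 \<le> f (y 0)"
      by (simp add: add.commute)
    then show "(norm (g (y k)))\<^sup>2 \<le> f (y 0) / (real k + 1)"
      by (simp add: pos_le_divide_eq mult.commute)
  qed
  have residual: "(\<lambda>k. g (y k)) \<longlonglongrightarrow> 0"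
  proof -
    have "(\<lambda>k. sqrt ((norm (g (y k)))\<^sup>2)) \<longlonglongrightarrow> sqrt 0"
      by (intro tendsto_real_sqrt summable_LIMSEQ_zero[OF summ])
    then show ?thesis by (simp add: tendsto_norm_zero_iff)
  qed
  have boundary: "(\<nexists>z. \<forall>w. f z \<le> f w) \<and> filterlim (\<lambda>k. norm (y k)) at_top sequentially"
    if b: "b \<in> frontier (moment_body A)"
  proof
    have "g z \<noteq> 0" for z
      using moment_map_gibbs_state_interior[OF assms(2-4), of z] b
      by (auto simp: g_def frontier_def)
    then have step: "f (z - g z /\<^sub>R (1/2)) < f z" for z
      using gradient_step_decrease[OF f L, of z] zero_less_norm_iff[of "g z"]
      by (smt (verit) zero_less_power L divide_pos_pos)
    show nomin: "\<nexists>z. \<forall>w. f z \<le> f w"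
      using step not_le by blast
    have "isCont f x" for x
      using deriv[of x] unfolding gderiv_def by (rule has_derivative_continuous)
    then have "continuous_on UNIV f"
      by (simp add: continuous_at_imp_continuous_on)
    moreover have "f z \<noteq> (INF z. f z)" for z
      using nomin cINF_lower[OF bdd] by (metis UNIV_I)
    ultimately show "filterlim (\<lambda>k. norm (y k)) at_top sequentially"
      using lim by (intro minimizing_sequence_norm_at_top)
  qed
  show ?thesis
    unfolding grad
    using summ sum_le dec rate lim bdd Inf residual[unfolded g_def] boundary
    by blast
qed

end
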